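(* For every $s\in\mathbb{N}$ with $s\ge 2$ and every $u>0$ there is a constant $C(s,u)>0$ depending only on $s$ and $u$ such that for any set $Y=\{y_1<y_2<\ldots<y_s\}\subset\mathbb{R}$ with $\hat\sigma/\hat D\ge u$ and any $\delta$ with $0<\delta<\frac12\hat\sigma$ we have $$\varepsilon_n(Y;\delta)\le\frac{\hat D}{2}\left(C(s,u)\frac{\delta}{\hat D}\right)^{\lfloor\frac{n+1}{s}\rfloor}\quad\text{for all } n\in\mathbb{N}.$$
   Context: $\mathcal{P}_n$ is the set of real algebraic polynomials of degree at most $n$. For a finite set $Y=\{y_1<\ldots<y_s\}\subset\mathbb{R}$ put $\hat\sigma:=\min_{i\ne j}|y_i-y_j|$ and $\hat D:=\operatorname{diam}Y=y_s-y_1$. For $0<\delta<\frac12\min_i|y_{i+1}-y_i|$, $\varepsilon_n(Y;\delta)$ denotes the smallest $\varepsilon$ such that there exists $P\in\mathcal{P}_n$ with $$|P(t)-y_j|\le\varepsilon\quad\text{for all } j=1,\ldots,s \text{ and all real } t \text{ with } |t-y_j|\le\delta.$$ *)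

theory Defs
  imports "HOL-Analysis.Analysis" "HOL-Computational_Algebra.Polynomial"
begin

definition min_sep :: "real set \<Rightarrow> real" where
  "min_sep Y = Min {\<bar>a - b\<bar> | a b. a \<in> Y \<and> b \<in> Y \<and> a \<noteq> b}"

definition approximable_within :: "nat \<Rightarrow> real set \<Rightarrow> real \<Rightarrow> real \<Rightarrow> bool" where
  "approximable_within n Y \<delta> \<epsilon> \<longleftrightarrow>
     (\<exists>p :: real poly. degree p \<le> n \<and>
        (\<forall>y\<in>Y. \<forall>t. \<bar>t - y\<bar> \<le> \<delta> \<longrightarrow> \<bar>poly p t - y\<bar> \<le> \<epsilon>))"

text \<open>The minimum exists for finite nonempty \<open>Y\<close> and positive \<open>\<delta>\<close>:
  see \<open>best_eps_attained\<close> and \<open>best_eps_le\<close> below.\<close>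

definition best_eps :: "nat \<Rightarrow> real set \<Rightarrow> real \<Rightarrow> real" where
  "best_eps n Y \<delta> = (LEAST \<epsilon>. approximable_within n Y \<delta> \<epsilon>)"

lemma diameter_eq_Max_minus_Min:
  fixes Y :: "real set"
  assumes "finite Y" "Y \<noteq> {}"
  shows "diameter Y = Max Y - Min Y"
proof (rule antisym)
  have "norm (x - y) \<le> Max Y - Min Y" if "x \<in> Y" "y \<in> Y" for x y
    using Max_ge[OF assms(1) that(1)] Max_ge[OF assms(1) that(2)]
      Min_le[OF assms(1) that(1)] Min_le[OF assms(1) that(2)] by simp
  then show "diameter Y \<le> Max Y - Min Y"
    using assms by (intro diameter_le) auto
  have "dist (Max Y) (Min Y) \<le> diameter Y"
    using assms by (intro diameter_bounded_bound finite_imp_bounded) auto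
  then show "Max Y - Min Y \<le> diameter Y" by (simp add: dist_real_def)
qed

lemma approximable_within_exists:
  assumes "finite Y"
  shows "\<exists>\<epsilon>. approximable_within n Y \<delta> \<epsilon>"
proof -
  have "\<bar>poly 0 t - y\<bar> \<le> (\<Sum>z\<in>Y. \<bar>z\<bar>)" if "y \<in> Y" for y t :: real
    using member_le_sum[of y Y "\<lambda>z. \<bar>z\<bar>"] that assms by simp
  then show ?thesis
    unfolding approximable_within_def by (metis degree_0 le0)
qed

lemma lagrange_basis_exists:
  fixes X :: "real set"
  assumes "finite X" "x \<in> X"
  shows "\<exists>L. degree L < card X \<and> (\<forall>z\<in>X. poly L z = (if z = x then 1 else 0))"
proof -
  define q where "q = (\<Prod>z\<in>X - {x}. [:- z, 1:])"
  define L where "L = smult (1 / poly q x) q"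
  have d: "degree q = card (X - {x})"
    unfolding q_def by (subst degree_prod_eq_sum_degree) auto
  have "poly q x \<noteq> 0" using assms by (simp add: q_def poly_prod)
  moreover have "poly q z = 0" if "z \<in> X" "z \<noteq> x" for z
    using assms that by (simp add: q_def poly_prod prod_zero_iff)
  moreover have "degree L \<le> degree q" unfolding L_def by (rule degree_smult_le)
  moreover have "card (X - {x}) < card X" using assms by (meson card_Diff1_less)
  ultimately show ?thesis using d by (intro exI[of _ L]) (auto simp: L_def)
qed

lemma bounded_subseq_finite:
  fixes v :: "nat \<Rightarrow> 'a \<Rightarrow> real"
  assumes "finite X" "\<forall>x\<in>X. bounded (range (\<lambda>k. v k x))"
  shows "\<exists>r w. strict_mono (r :: nat \<Rightarrow> nat) \<and> (\<forall>x\<in>X. (\<lambda>k. v (r k) x) \<longlonglongrightarrow> w x)"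
  using assms
proof (induction X rule: finite_induct)
  case empty
  show ?case by (intro exI[of _ id]) (auto simp: strict_mono_def)
next
  case (insert x X)
  then obtain r w where r: "strict_mono (r :: nat \<Rightarrow> nat)"
    and w: "\<And>z. z \<in> X \<Longrightarrow> (\<lambda>k. v (r k) z) \<longlonglongrightarrow> w z" by auto
  have "bounded (range (\<lambda>k. v (r k) x))"
    by (rule bounded_subset[of "range (\<lambda>k. v k x)"]) (use insert.prems in auto)
  then obtain l r' where r': "strict_mono (r' :: nat \<Rightarrow> nat)"
    and l: "((\<lambda>k. v (r k) x) \<circ> r') \<longlonglongrightarrow> l"
    using bounded_imp_convergent_subsequence by blast
  have "(\<lambda>k. v ((r \<circ> r') k) z) \<longlonglongrightarrow> (w(x := l)) z" if "z \<in> insert x X" for z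
  proof (cases "z = x")
    case True
    then show ?thesis using l by (simp add: o_def)
  next
    case False
    then show ?thesis using LIMSEQ_subseq_LIMSEQ[OF w r', of z] that by (simp add: o_def)
  qed
  then show ?case using strict_mono_o[OF r r'] by blast
qed

lemma approximable_within_least:
  assumes "finite Y" "Y \<noteq> {}" "\<delta> > 0"
  shows "\<exists>\<epsilon>. approximable_within n Y \<delta> \<epsilon> \<and> (\<forall>\<epsilon>'. approximable_within n Y \<delta> \<epsilon>' \<longrightarrow> \<epsilon> \<le> \<epsilon>')"
proof -
  define S where "S = {\<epsilon>. approximable_within n Y \<delta> \<epsilon>}"
  obtain y0 where y0: "y0 \<in> Y" using assms by blast
  have nn: "0 \<le> e" if "e \<in> S" for e
  proof -
    from that obtain p :: "real poly" where
      "\<forall>y\<in>Y. \<forall>t. \<bar>t - y\<bar> \<le> \<delta> \<longrightarrow> \<bar>poly p t - y\<bar> \<le> e"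
      unfolding S_def approximable_within_def by blast
    moreover have "\<bar>y0 - y0\<bar> \<le> \<delta>" using assms(3) by simp
    ultimately have "\<bar>poly p y0 - y0\<bar> \<le> e" using y0 by blast
    then show ?thesis using abs_ge_zero order_trans by blast
  qed
  have ne: "S \<noteq> {}" using approximable_within_exists[OF assms(1)] by (auto simp: S_def)
  have bb: "bdd_below S" using nn by (meson bdd_belowI)
  have "\<exists>e\<in>S. e < Inf S + 1 / real (Suc k)" for k
    by (subst cInf_less_iff[OF ne bb, symmetric]) simp
  then obtain e where e: "\<And>k. e k \<in> S" "\<And>k. e k < Inf S + 1 / real (Suc k)" by metis
  have "\<exists>p :: real poly. degree p \<le> n \<and>
      (\<forall>y\<in>Y. \<forall>t. \<bar>t - y\<bar> \<le> \<delta> \<longrightarrow> \<bar>poly p t - y\<bar> \<le> e k)" for k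
    using e(1)[of k] unfolding S_def approximable_within_def by simp
  then obtain p :: "nat \<Rightarrow> real poly" where p: "\<And>k. degree (p k) \<le> n"
    "\<And>k y t. y \<in> Y \<Longrightarrow> \<bar>t - y\<bar> \<le> \<delta> \<Longrightarrow> \<bar>poly (p k) t - y\<bar> \<le> e k" by metis
  have "infinite {y0 - \<delta>..y0 + \<delta>}" using assms(3) by (simp add: infinite_Icc)
  then obtain X where X: "finite X" "card X = Suc n" "X \<subseteq> {y0 - \<delta>..y0 + \<delta>}"
    using infinite_arbitrarily_large by blast
  have "bounded (range (\<lambda>k. poly (p k) x))" if "x \<in> X" for x
  proof (rule boundedI)
    fix z assume "z \<in> range (\<lambda>k. poly (p k) x)"
    then obtain k where z: "z = poly (p k) x" by blast
    have "x \<in> {y0 - \<delta>..y0 + \<delta>}" using X(3) that by blast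
    then have "\<bar>x - y0\<bar> \<le> \<delta>" by (simp add: abs_le_iff)
    from p(2)[OF y0 this, of k] have "\<bar>z - y0\<bar> \<le> e k" by (simp add: z)
    moreover have "1 / real (Suc k) \<le> 1" by simp
    ultimately show "norm z \<le> \<bar>y0\<bar> + Inf S + 1" using e(2)[of k] unfolding real_norm_def by linarith
  qed
  then obtain r w where r: "strict_mono (r :: nat \<Rightarrow> nat)"
    and w: "\<And>x. x \<in> X \<Longrightarrow> (\<lambda>k. poly (p (r k)) x) \<longlonglongrightarrow> w x"
    using bounded_subseq_finite[OF X(1), of "\<lambda>k x. poly (p k) x"] by blast
  obtain L where L: "\<And>x. x \<in> X \<Longrightarrow> degree (L x) < card X"
    "\<And>x z. x \<in> X \<Longrightarrow> z \<in> X \<Longrightarrow> poly (L x) z = (if z = x then 1 else 0)"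
    using lagrange_basis_exists[OF X(1)] by metis
  define q where "q = (\<Sum>x\<in>X. smult (w x) (L x))"
  have deg: "degree (\<Sum>x\<in>X. smult (c x) (L x)) \<le> n" for c
    by (rule degree_sum_le[OF X(1)])
       (metis L(1) X(2) degree_smult_le less_Suc_eq_le order_trans)
  have rep: "p k = (\<Sum>x\<in>X. smult (poly (p k) x) (L x))" for k
  proof (rule poly_eqI_degree[of X])
    fix z assume z: "z \<in> X"
    have "poly (\<Sum>x\<in>X. smult (poly (p k) x) (L x)) z = (\<Sum>x\<in>X. if x = z then poly (p k) x else 0)"
      unfolding poly_sum by (rule sum.cong) (use L(2) z in auto)
    then show "poly (p k) z = poly (\<Sum>x\<in>X. smult (poly (p k) x) (L x)) z"
      using z X(1) by simp
  qed (use X p(1)[of k] deg[of "poly (p k)"] in auto)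
  have lim: "(\<lambda>k. poly (p (r k)) t) \<longlonglongrightarrow> poly q t" for t
  proof -
    have "(\<lambda>k. \<Sum>x\<in>X. poly (p (r k)) x * poly (L x) t) \<longlonglongrightarrow> (\<Sum>x\<in>X. w x * poly (L x) t)"
      by (intro tendsto_sum tendsto_mult w tendsto_const)
    moreover have "(\<Sum>x\<in>X. poly (p k) x * poly (L x) t) = poly (p k) t" for k
      by (subst (2) rep) (simp add: poly_sum)
    ultimately show ?thesis by (simp add: q_def poly_sum)
  qed
  have up: "(\<lambda>k. Inf S + 1 / real (Suc (r k))) \<longlonglongrightarrow> Inf S"
  proof -
    have "(\<lambda>k. Inf S + 1 / real (Suc k)) \<longlonglongrightarrow> Inf S + 0"
      by (intro tendsto_add tendsto_const LIMSEQ_Suc[OF lim_1_over_n])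
    from LIMSEQ_subseq_LIMSEQ[OF this r] show ?thesis by (simp add: o_def)
  qed
  have "\<bar>poly q t - y\<bar> \<le> Inf S" if "y \<in> Y" "\<bar>t - y\<bar> \<le> \<delta>" for y t
  proof (rule LIMSEQ_le[OF _ up])
    show "(\<lambda>k. \<bar>poly (p (r k)) t - y\<bar>) \<longlonglongrightarrow> \<bar>poly q t - y\<bar>"
      by (intro tendsto_rabs tendsto_diff lim tendsto_const)
    show "\<exists>N. \<forall>k\<ge>N. \<bar>poly (p (r k)) t - y\<bar> \<le> Inf S + 1 / real (Suc (r k))"
      using p(2)[OF that] e(2) by (meson less_imp_le order_trans)
  qed
  then have "approximable_within n Y \<delta> (Inf S)"
    unfolding approximable_within_def using deg[of w] q_def by blast
  moreover have "Inf S \<le> e'" if "approximable_within n Y \<delta> e'" for e'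
    using that bb by (simp add: S_def cInf_lower)
  ultimately show ?thesis by blast
qed

lemma best_eps_attained:
  assumes "finite Y" "Y \<noteq> {}" "\<delta> > 0"
  shows "approximable_within n Y \<delta> (best_eps n Y \<delta>)"
  using approximable_within_least[OF assms, of n] unfolding best_eps_def
  by (metis LeastI2_order)

lemma best_eps_le:
  assumes "finite Y" "Y \<noteq> {}" "\<delta> > 0" "approximable_within n Y \<delta> \<epsilon>"
  shows "best_eps n Y \<delta> \<le> \<epsilon>"
proof -
  obtain e where e: "approximable_within n Y \<delta> e"
    "\<And>e'. approximable_within n Y \<delta> e' \<Longrightarrow> e \<le> e'"
    using approximable_within_least[OF assms(1-3), of n] by blast
  have "best_eps n Y \<delta> = e" unfolding best_eps_def by (rule Least_equality) (use e in auto)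
  then show ?thesis using e assms(4) by simp
qed

end

theory Submission
  imports Defs "HOL-Number_Theory.Cong"
begin

text \<open>With \<open>k = (n + 1) div s\<close> take the Hermite interpolant \<open>P = (\<Sum>y\<in>Y. y H\<^sub>y)\<close> of degree less
  than \<open>s k\<close>, where \<open>H\<^sub>y\<close> is \<open>1\<close> to order \<open>k\<close> at \<open>y\<close> and vanishes to order \<open>k\<close> at the other nodes.
  Explicitly \<open>H\<^sub>y(t) = T(t - y) * (\<Prod>z\<noteq>y. (t - z) / (y - z)) ^ k\<close>, where \<open>T\<close> is the truncation at
  order \<open>k\<close> of the power series of \<open>(\<Prod>z\<noteq>y. 1 + x / (y - z)) ^ (-k)\<close>. Geometric majorants, evaluated
  at half the minimal separation, bound the coefficients of \<open>T\<close>, so \<open>T\<close> grows at most exponentially in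
  \<open>k\<close>. Counting zeros gives \<open>(\<Sum>y\<in>Y. H\<^sub>y) = 1\<close>, so near \<open>z\<close> the error \<open>P - z = (\<Sum>y\<noteq>z. (y - z) H\<^sub>y)\<close>
  involves only the \<open>H\<^sub>y\<close> that are small there, and no Taylor remainder has to be estimated.\<close>

section \<open>Coefficientwise majorants\<close>

text \<open>The majorant is the first argument. The relation forces its coefficients to be
  nonnegative, which is what makes it compatible with products.\<close>

definition majorizes :: "real poly \<Rightarrow> real poly \<Rightarrow> bool" where
  "majorizes g p \<longleftrightarrow> (\<forall>m. \<bar>coeff p m\<bar> \<le> coeff g m)"

lemma majorizes_1: "majorizes 1 1"
  by (simp add: majorizes_def)

lemma majorizes_mult:
  assumes "majorizes g p" "majorizes h q"
  shows "majorizes (g * h) (p * q)"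
  unfolding majorizes_def
proof
  fix m
  have "\<bar>coeff (p * q) m\<bar> \<le> (\<Sum>i\<le>m. \<bar>coeff p i * coeff q (m - i)\<bar>)"
    unfolding coeff_mult by (rule sum_abs)
  also have "\<dots> \<le> (\<Sum>i\<le>m. coeff g i * coeff h (m - i))"
    unfolding abs_mult
    by (intro sum_mono mult_mono) (use assms in \<open>auto simp: majorizes_def intro: order_trans[OF abs_ge_zero]\<close>)
  finally show "\<bar>coeff (p * q) m\<bar> \<le> coeff (g * h) m"
    by (simp add: coeff_mult)
qed

lemma majorizes_power: "majorizes g p \<Longrightarrow> majorizes (g ^ n) (p ^ n)"
  by (induction n) (simp_all add: majorizes_1 majorizes_mult)

lemma majorizes_prod:
  assumes "\<And>a. a \<in> A \<Longrightarrow> majorizes g (f a)"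
  shows "majorizes (g ^ card A) (\<Prod>a\<in>A. f a)"
  using assms
  by (induction A rule: infinite_finite_induct) (simp_all add: majorizes_1 majorizes_mult)

text \<open>All terms of \<open>poly g r\<close> are nonnegative, so each is at most the whole
  value, as in Cauchy's coefficient estimate.\<close>

lemma majorizes_coeff_bound:
  assumes "majorizes g p" "r \<ge> 0"
  shows "\<bar>coeff p m\<bar> * r ^ m \<le> poly g r"
proof -
  have nonneg: "0 \<le> coeff g i" for i
    using assms(1) order_trans[OF abs_ge_zero] unfolding majorizes_def by blast
  have "\<bar>coeff p m\<bar> * r ^ m \<le> coeff g m * r ^ m"
    using assms by (intro mult_right_mono) (auto simp: majorizes_def)
  also have "\<dots> \<le> poly g r"
  proof (cases "m \<le> degree g")
    case True
    then show ?thesis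
      unfolding poly_altdef using nonneg assms(2)
      by (intro member_le_sum) auto
  next
    case False
    then have "coeff g m = 0" by (simp add: coeff_eq_0)
    then show ?thesis
      unfolding poly_altdef using nonneg assms(2) by (simp add: sum_nonneg)
  qed
  finally show ?thesis .
qed

section \<open>Truncated inverses of power series\<close>

definition geometric_poly :: "nat \<Rightarrow> real \<Rightarrow> real poly" where
  "geometric_poly k c = (\<Sum>m<k. monom (c ^ m) m)"

lemma coeff_geometric_poly: "coeff (geometric_poly k c) m = (if m < k then c ^ m else 0)"
  by (simp add: geometric_poly_def coeff_sum)

text \<open>With \<open>z = monom c 1\<close> the product telescopes to \<open>1 - z ^ k\<close>.
  Congruence modulo \<open>monom 1 k\<close> expresses equality of power series below order
  \<open>k\<close>.\<close>

lemma geometric_poly_inverse: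
  "[[:1, - c:] * geometric_poly k c = 1] (mod monom 1 k)"
proof -
  define z where "z = monom c 1"
  have z: "monom (c ^ m) m = z ^ m" for m
    by (simp add: z_def monom_power)
  have "[:1, - c:] = 1 - z"
    by (simp add: z_def monom_Suc monom_0 one_pCons)
  then have "[:1, - c:] * geometric_poly k c = 1 - z ^ k"
    by (simp add: geometric_poly_def z one_diff_power_eq)
  moreover have "monom 1 k dvd z ^ k"
    unfolding z[symmetric] by (simp add: monom_1_dvd_iff')
  ultimately show ?thesis
    by (simp add: cong_iff_dvd_diff)
qed

lemma geometric_poly_majorizes:
  assumes "\<bar>c\<bar> \<le> b"
  shows "majorizes (geometric_poly k b) (geometric_poly k c)"
  using assms by (simp add: majorizes_def coeff_geometric_poly power_abs power_mono)

text \<open>At half the radius of convergence the common ratio is 1/2, so the bound is independent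
  of \<open>k\<close> and \<open>c\<close>.\<close>

lemma poly_geometric_poly_le_2:
  assumes "c \<noteq> 0"
  shows "poly (geometric_poly k c) (1 / (2 * c)) \<le> 2"
proof -
  have "poly (geometric_poly k c) (1 / (2 * c)) = (\<Sum>m<k. (1 / 2) ^ m)"
    unfolding geometric_poly_def poly_sum poly_monom
    using assms by (intro sum.cong) (auto simp: power_mult_distrib power_divide)
  also have "\<dots> \<le> 2"
    by (simp add: geometric_sum)
  finally show ?thesis .
qed

text \<open>Geometric polynomials invert the factors one by one, and truncation keeps the residue
  class. For the bound, every \<open>1 / a\<close> is majorized by \<open>1 / \<sigma>\<close>. The
  set \<open>A\<close> will consist of the differences of one node from the others.\<close>

lemma truncated_inverse_power:
  fixes A :: "real set"
  assumes "finite A" "0 < \<sigma>" "\<And>a. a \<in> A \<Longrightarrow> \<sigma> \<le> \<bar>a\<bar>" "\<sigma> \<le> 2 * R"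
  obtains T where "degree T \<le> k - 1"
    and "[(\<Prod>a\<in>A. [:1, 1 / a:]) ^ k * T = 1] (mod monom 1 k)"
    and "\<And>x. \<bar>x\<bar> \<le> R \<Longrightarrow> \<bar>poly T x\<bar> \<le> (2 ^ (card A + 1) * (2 * R / \<sigma>)) ^ k"
proof
  define G where "G = (\<Prod>a\<in>A. geometric_poly k (- 1 / a)) ^ k"
  \<comment> \<open>The degree of \<open>G\<close> can grow quadratically in \<open>k\<close>; the
    cutoff keeps only the part that the congruence sees.\<close>
  define T where "T = poly_cutoff k G"
  have high: "coeff T m = 0" if "k \<le> m" for m
    using that by (simp add: T_def coeff_poly_cutoff)
  then show "degree T \<le> k - 1"
    by (intro degree_le) auto
  have "[(\<Prod>a\<in>A. [:1, 1 / a:] * geometric_poly k (- 1 / a)) ^ k = (\<Prod>a\<in>A. 1) ^ k] (mod monom 1 k)"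
    by (intro cong_pow cong_prod) (use geometric_poly_inverse[of "- 1 / a" for a] in auto)
  then have "[(\<Prod>a\<in>A. [:1, 1 / a:]) ^ k * G = 1] (mod monom 1 k)"
    by (simp only: G_def prod.distrib power_mult_distrib prod.neutral_const power_one)
  moreover have "[T = G] (mod monom 1 k)"
    by (simp add: cong_iff_dvd_diff monom_1_dvd_iff' T_def coeff_poly_cutoff)
  ultimately show "[(\<Prod>a\<in>A. [:1, 1 / a:]) ^ k * T = 1] (mod monom 1 k)"
    by (meson cong_mult cong_refl cong_trans)
  have maj: "majorizes ((geometric_poly k (1 / \<sigma>) ^ card A) ^ k) G"
    unfolding G_def using assms
    by (intro majorizes_power majorizes_prod geometric_poly_majorizes)
      (auto simp: abs_divide intro!: divide_left_mono mult_pos_pos dest: order.strict_trans2)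
  \<comment> \<open>The point \<open>\<sigma> / 2\<close> is half the radius of convergence, so each
    of the \<open>card A * k\<close> factors of the majorant contributes at most 2.\<close>
  have "0 \<le> poly (geometric_poly k (1 / \<sigma>)) (\<sigma> / 2)"
    using assms(2) by (simp add: geometric_poly_def poly_sum poly_monom sum_nonneg)
  moreover have "poly (geometric_poly k (1 / \<sigma>)) (\<sigma> / 2) \<le> 2"
    using poly_geometric_poly_le_2[of "1 / \<sigma>" k] assms(2) by simp
  ultimately have "poly ((geometric_poly k (1 / \<sigma>) ^ card A) ^ k) (\<sigma> / 2) \<le> (2 ^ card A) ^ k"
    by (simp add: power_mono)
  then have coeff: "\<bar>coeff T m\<bar> * (\<sigma> / 2) ^ m \<le> (2 ^ card A) ^ k" for m
    using majorizes_coeff_bound[OF maj, of "\<sigma> / 2" m] assms(2)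
    by (auto simp: T_def coeff_poly_cutoff)
  fix x assume x: "\<bar>x\<bar> \<le> R"
  have "\<bar>coeff T m * x ^ m\<bar> \<le> (2 ^ card A) ^ k * (2 * R / \<sigma>) ^ k" if "m < k" for m
  proof -
    have "\<bar>coeff T m * x ^ m\<bar> = (\<bar>coeff T m\<bar> * (\<sigma> / 2) ^ m) * (2 * \<bar>x\<bar> / \<sigma>) ^ m"
      using assms(2) by (simp add: abs_mult power_abs field_simps)
    also have "\<dots> \<le> (2 ^ card A) ^ k * (2 * R / \<sigma>) ^ m"
      using x assms(2) by (intro mult_mono coeff power_mono divide_right_mono) auto
    \<comment> \<open>The base is at least 1 because \<open>\<sigma> \<le> 2 * R\<close>.\<close>
    also have "\<dots> \<le> (2 ^ card A) ^ k * (2 * R / \<sigma>) ^ k"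
      using that assms(2,4) by (intro mult_left_mono power_increasing) (auto simp: field_simps)
    finally show ?thesis .
  qed
  then have "(\<Sum>m<k. \<bar>coeff T m * x ^ m\<bar>) \<le> of_nat (card {..<k}) * ((2 ^ card A) ^ k * (2 * R / \<sigma>) ^ k)"
    by (intro sum_bounded_above) auto
  moreover have "poly T x = (\<Sum>m<k. coeff T m * x ^ m)"
    unfolding poly_altdef using high
    by (intro sum.mono_neutral_cong) (auto simp: coeff_eq_0 not_less)
  ultimately have "\<bar>poly T x\<bar> \<le> real k * ((2 ^ card A) ^ k * (2 * R / \<sigma>) ^ k)"
    by (metis card_lessThan order_trans sum_abs)
  \<comment> \<open>The number \<open>k\<close> of terms is absorbed into \<open>2 ^ k\<close>,
    whence the \<open>+ 1\<close> in the exponent of 2.\<close>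
  also have "\<dots> \<le> 2 ^ k * ((2 ^ card A) ^ k * (2 * R / \<sigma>) ^ k)"
    using assms(2,4) by (intro mult_right_mono) (auto simp: of_nat_less_two_power less_imp_le)
  finally show "\<bar>poly T x\<bar> \<le> (2 ^ (card A + 1) * (2 * R / \<sigma>)) ^ k"
    by (simp only: power_add power_one_right power_mult_distrib mult_ac)
qed

section \<open>Hermite fundamental polynomials\<close>

lemma pcompose_power: "pcompose (p ^ n) q = pcompose p q ^ n"
  for p q :: "'a::comm_ring_1 poly"
  by (induction n) (simp_all add: pcompose_1 pcompose_mult)

text \<open>Otherwise the zeros in \<open>X\<close>, counted with multiplicity, would outnumber the
  degree.\<close>

lemma poly_eq_0_if_high_order:
  fixes p :: "'a::idom poly"
  assumes "finite X" "\<And>x. x \<in> X \<Longrightarrow> [:- x, 1:] ^ k dvd p" "degree p < card X * k"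
  shows "p = 0"
proof (rule ccontr)
  assume p: "p \<noteq> 0"
  have k: "0 < k" using assms(3) by (cases k) auto
  have ord: "k \<le> order x p" if "x \<in> X" for x
    using assms(2)[OF that] p by (simp add: order_divides)
  have "card X * k \<le> (\<Sum>x\<in>X. order x p)"
    using sum_mono[of X "\<lambda>_. k" "\<lambda>x. order x p"] ord by simp
  \<comment> \<open>Since \<open>k > 0\<close>, every point of \<open>X\<close> is a root.\<close>
  also have "\<dots> \<le> (\<Sum>x | poly p x = 0. order x p)"
    using ord k p by (intro sum_mono2) (use poly_roots_finite[OF p] in \<open>auto simp: order_root dest: ord\<close>)
  also have "\<dots> \<le> degree p" by (rule sum_order_le_degree[OF p])
  finally show False using assms(3) by simp
qed

text \<open>The \<open>k\<close>-th power of the Lagrange product supplies the zeros at the other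
  nodes, and the truncated inverse corrects it to 1 at \<open>y\<close>. The bound keeps the factors
  \<open>\<bar>t - z\<bar>\<close>, since their smallness near another node is what is used
  later.\<close>

lemma hermite_fundamental_polynomial:
  fixes Y :: "real set"
  assumes "finite Y" "y \<in> Y" "0 < \<sigma>" "\<sigma> \<le> 2 * R" "0 < k"
    and sep: "\<And>z. z \<in> Y - {y} \<Longrightarrow> \<sigma> \<le> \<bar>y - z\<bar>"
  obtains H where "degree H < card Y * k"
    and "[:- y, 1:] ^ k dvd H - 1"
    and "\<And>z. z \<in> Y - {y} \<Longrightarrow> [:- z, 1:] ^ k dvd H"
    and "\<And>t. \<bar>t - y\<bar> \<le> R \<Longrightarrow>
      \<bar>poly H t\<bar> \<le> ((\<Prod>z\<in>Y - {y}. \<bar>t - z\<bar> / \<sigma>) * (2 ^ card Y * (2 * R / \<sigma>))) ^ k"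
proof -
  define Z where "Z = Y - {y}"
  have finZ: "finite Z" and ne: "\<And>z. z \<in> Z \<Longrightarrow> y - z \<noteq> 0"
    using assms by (auto simp: Z_def)
  have inj: "inj_on (\<lambda>z. y - z) Z" by (auto simp: inj_on_def)
  have cardY: "card Z + 1 = card Y"
    using assms(1,2) unfolding Z_def using card_Suc_Diff1[of Y y] by simp
  obtain T where T: "degree T \<le> k - 1"
    "[(\<Prod>a\<in>(\<lambda>z. y - z) ` Z. [:1, 1 / a:]) ^ k * T = 1] (mod monom 1 k)"
    "\<And>x. \<bar>x\<bar> \<le> R \<Longrightarrow> \<bar>poly T x\<bar> \<le> (2 ^ (card ((\<lambda>z. y - z) ` Z) + 1) * (2 * R / \<sigma>)) ^ k"
    by (rule truncated_inverse_power[of "(\<lambda>z. y - z) ` Z" \<sigma> R k])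
      (use finZ assms in \<open>auto simp: Z_def\<close>)
  \<comment> \<open>In the local variable x = t - y the factor (t - z) / (y - z) becomes 1 + x / (y
    - z); composition with \<open>[:- y, 1:]\<close> returns to t.\<close>
  define W where "W = (\<Prod>z\<in>Z. [:1, 1 / (y - z):]) ^ k"
  define H where "H = pcompose (W * T) [:- y, 1:]"
  have W: "(\<Prod>a\<in>(\<lambda>z. y - z) ` Z. [:1, 1 / a:]) ^ k = W"
    by (simp add: W_def prod.reindex[OF inj])
  have shift: "pcompose [:1, 1 / (y - z):] [:- y, 1:] = smult (1 / (y - z)) [:- z, 1:]" if "z \<in> Z" for z
    using ne[OF that] by (simp add: pcompose_pCons field_simps)
  have H: "H = (\<Prod>z\<in>Z. smult (1 / (y - z)) [:- z, 1:]) ^ k * pcompose T [:- y, 1:]"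
    by (simp add: H_def W_def pcompose_mult pcompose_power pcompose_prod shift)
  show thesis
  proof (rule that[of H])
    have "degree H = degree (W * T)" by (simp add: H_def degree_pcompose)
    also have "\<dots> \<le> degree W + degree T" by (rule degree_mult_le)
    also have "degree W \<le> degree (\<Prod>z\<in>Z. [:1, 1 / (y - z):]) * k"
      unfolding W_def by (rule degree_power_le)
    also have "degree (\<Prod>z\<in>Z. [:1, 1 / (y - z):]) \<le> (\<Sum>z\<in>Z. 1)"
      using degree_prod_sum_le[OF finZ, of "\<lambda>z. [:1, 1 / (y - z):]"]
      by (rule order_trans) (intro sum_mono, simp)
    finally have "degree H \<le> card Z * k + (k - 1)"
      using T(1) by (simp add: add_mono)
    \<comment> \<open>Here \<open>0 < k\<close> gives the strict inequality that the zero count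
      requires.\<close>
    then show "degree H < card Y * k"
      using assms(5) unfolding cardY[symmetric] by simp
  next
    have "monom 1 k dvd W * T - 1"
      using T(2) by (simp add: W cong_iff_dvd_diff)
    then obtain Q where "W * T - 1 = monom 1 k * Q" by blast
    then have "H - 1 = pcompose (monom 1 k * Q) [:- y, 1:]"
      by (metis H_def pcompose_1 pcompose_diff)
    also have "monom (1::real) k = [:0, 1:] ^ k"
      by (simp add: monom_altdef)
    also have "pcompose ([:0, 1:] ^ k * Q) [:- y, 1:] = [:- y, 1:] ^ k * pcompose Q [:- y, 1:]"
      by (simp add: pcompose_mult pcompose_power pcompose_pCons)
    finally show "[:- y, 1:] ^ k dvd H - 1" by simp
  next
    fix z assume "z \<in> Y - {y}"
    then have z: "z \<in> Z" by (simp add: Z_def)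
    have "[:- z, 1:] dvd smult (1 / (y - z)) [:- z, 1:]"
      by (rule dvd_smult) simp
    also have "\<dots> dvd (\<Prod>z\<in>Z. smult (1 / (y - z)) [:- z, 1:])"
      by (rule dvd_prodI[OF finZ z])
    finally show "[:- z, 1:] ^ k dvd H"
      unfolding H by (intro dvd_mult2 dvd_power_same)
  next
    fix t assume t: "\<bar>t - y\<bar> \<le> R"
    have "\<bar>poly H t\<bar> = (\<Prod>z\<in>Z. \<bar>t - z\<bar> / \<bar>y - z\<bar>) ^ k * \<bar>poly T (t - y)\<bar>"
      unfolding H 
      by (simp add: poly_pcompose poly_prod abs_mult power_abs abs_prod diff_divide_distrib[symmetric])
    also have "\<dots> \<le> (\<Prod>z\<in>Z. \<bar>t - z\<bar> / \<sigma>) ^ k * (2 ^ card Y * (2 * R / \<sigma>)) ^ k"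
    proof (intro mult_mono power_mono prod_mono conjI)
      show "\<bar>poly T (t - y)\<bar> \<le> (2 ^ card Y * (2 * R / \<sigma>)) ^ k"
        using T(3)[OF t] by (simp only: card_image[OF inj] cardY)
    qed (use assms in \<open>auto simp: Z_def intro!: divide_left_mono zero_le_power prod_nonneg mult_pos_pos\<close>)
    finally show "\<bar>poly H t\<bar> \<le> ((\<Prod>z\<in>Y - {y}. \<bar>t - z\<bar> / \<sigma>) * (2 ^ card Y * (2 * R / \<sigma>))) ^ k"
      by (simp only: Z_def power_mult_distrib mult_ac)
  qed
qed

text \<open>The difference of both sides vanishes to order \<open>k\<close> at every node, but its
  degree is below \<open>card Y * k\<close>.\<close>

lemma hermite_partition_of_unity:
  fixes H :: "'a::idom \<Rightarrow> 'a poly"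
  assumes "finite Y"
    and "\<And>y. y \<in> Y \<Longrightarrow> degree (H y) < card Y * k"
    and "\<And>y. y \<in> Y \<Longrightarrow> [:- y, 1:] ^ k dvd H y - 1"
    and "\<And>y z. y \<in> Y \<Longrightarrow> z \<in> Y - {y} \<Longrightarrow> [:- z, 1:] ^ k dvd H y"
    and "0 < card Y * k"
  shows "(\<Sum>y\<in>Y. H y) = 1"
proof -
  have "(\<Sum>y\<in>Y. H y) - 1 = 0"
  proof (rule poly_eq_0_if_high_order[OF assms(1)])
    fix z assume z: "z \<in> Y"
    have "(\<Sum>y\<in>Y. H y) - 1 = (H z - 1) + (\<Sum>y\<in>Y - {z}. H y)"
      by (simp add: sum.remove[OF assms(1) z])
    then show "[:- z, 1:] ^ k dvd (\<Sum>y\<in>Y. H y) - 1"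
      using assms(3)[OF z] assms(4)[OF _ DiffI[OF z]] by (metis (no_types, lifting) DiffD1 DiffD2 dvd_add dvd_sum empty_iff insert_iff)
  next
    have "degree (\<Sum>y\<in>Y. H y) < card Y * k"
      by (rule degree_sum_less) (use assms in auto)
    then show "degree ((\<Sum>y\<in>Y. H y) - 1) < card Y * k"
      using assms(5) by (intro degree_diff_less) auto
  qed
  then show ?thesis by simp
qed

section \<open>Interpolation error near the nodes\<close>

lemma approximable_within_hermite:
  fixes Y :: "real set"
  assumes "finite Y" "0 < \<sigma>" "0 < k" "card Y * k \<le> n + 1" "0 < \<delta>" "2 \<le> card Y"
    and sep: "\<And>y z. y \<in> Y \<Longrightarrow> z \<in> Y \<Longrightarrow> y \<noteq> z \<Longrightarrow> \<sigma> \<le> \<bar>y - z\<bar>"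
    and D: "\<And>y z. y \<in> Y \<Longrightarrow> z \<in> Y \<Longrightarrow> \<bar>y - z\<bar> \<le> D"
    and "\<delta> \<le> D" "\<sigma> \<le> D"
  shows "approximable_within n Y \<delta>
    (real (card Y) * D * (\<delta> / \<sigma> * (2 * D / \<sigma>) ^ (card Y - 2) * (2 ^ card Y * (4 * D / \<sigma>))) ^ k)"
proof -
  define B where "B = \<delta> / \<sigma> * (2 * D / \<sigma>) ^ (card Y - 2) * (2 ^ card Y * (4 * D / \<sigma>))"
  \<comment> \<open>The radius \<open>2 * D\<close> suffices: a point within
    \<open>\<delta> \<le> D\<close> of one node is within \<open>2 * D\<close> of all of
    them.\<close>
  have "\<exists>H. degree H < card Y * k \<and> [:- y, 1:] ^ k dvd H - 1 \<and>
      (\<forall>z\<in>Y - {y}. [:- z, 1:] ^ k dvd H) \<and>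
      (\<forall>t. \<bar>t - y\<bar> \<le> 2 * D \<longrightarrow>
        \<bar>poly H t\<bar> \<le> ((\<Prod>z\<in>Y - {y}. \<bar>t - z\<bar> / \<sigma>) * (2 ^ card Y * (2 * (2 * D) / \<sigma>))) ^ k)"
    if "y \<in> Y" for y :: real
    by (rule hermite_fundamental_polynomial[of Y y \<sigma> "2 * D" k])
      (use that assms in force)+
  then obtain H where H: "\<And>y. y \<in> Y \<Longrightarrow> degree (H y) < card Y * k"
    "\<And>y. y \<in> Y \<Longrightarrow> [:- y, 1:] ^ k dvd H y - 1"
    "\<And>y z. y \<in> Y \<Longrightarrow> z \<in> Y - {y} \<Longrightarrow> [:- z, 1:] ^ k dvd H y"
    "\<And>y t. y \<in> Y \<Longrightarrow> \<bar>t - y\<bar> \<le> 2 * D \<Longrightarrow>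
        \<bar>poly (H y) t\<bar> \<le> ((\<Prod>z\<in>Y - {y}. \<bar>t - z\<bar> / \<sigma>) * (2 ^ card Y * (2 * (2 * D) / \<sigma>))) ^ k"
    by metis
  have unity: "(\<Sum>y\<in>Y. H y) = 1"
    by (rule hermite_partition_of_unity[OF assms(1) H(1,2,3)]) (use assms in auto)
  define P where "P = (\<Sum>y\<in>Y. smult y (H y))"
  have "degree P < card Y * k"
    unfolding P_def
    by (rule degree_sum_less) (use H(1) assms in \<open>auto intro: le_less_trans[OF degree_smult_le]\<close>)
  then have "degree P \<le> n" using assms(4) by simp
  moreover have "\<bar>poly P t - y\<bar> \<le> card Y * D * B ^ k" if y: "y \<in> Y" and t: "\<bar>t - y\<bar> \<le> \<delta>" for y t
  proof -
    have far: "\<bar>t - x\<bar> \<le> 2 * D" if "x \<in> Y" for x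
      using D[OF y that] t assms(9) by linarith
    have HB: "\<bar>poly (H x) t\<bar> \<le> B ^ k" if x: "x \<in> Y" "x \<noteq> y" for x
    proof -
      \<comment> \<open>The factor of the nearby node \<open>y\<close> yields
        \<open>\<delta> / \<sigma>\<close>; the other \<open>card Y - 2\<close> factors are only
        known to be bounded.\<close>
      have "(\<Prod>z\<in>Y - {x}. \<bar>t - z\<bar> / \<sigma>) = \<bar>t - y\<bar> / \<sigma> * (\<Prod>z\<in>Y - {x} - {y}. \<bar>t - z\<bar> / \<sigma>)"
        using assms(1) y x by (intro prod.remove) auto
      also have "\<dots> \<le> \<delta> / \<sigma> * (\<Prod>z\<in>Y - {x} - {y}. 2 * D / \<sigma>)"
        using t far assms by (intro mult_mono prod_mono prod_nonneg conjI divide_right_mono) auto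
      also have "\<dots> = \<delta> / \<sigma> * (2 * D / \<sigma>) ^ (card Y - 2)"
        using assms(1) x y by (simp add: numeral_2_eq_2)
      finally have "(\<Prod>z\<in>Y - {x}. \<bar>t - z\<bar> / \<sigma>) * (2 ^ card Y * (2 * (2 * D) / \<sigma>)) \<le> B"
        unfolding B_def using assms by (intro mult_mono) auto
      then show ?thesis
        using H(4)[OF x(1) far[OF x(1)]] assms
        by (elim order_trans) (intro power_mono mult_nonneg_nonneg prod_nonneg, auto)
    qed
    have "B \<ge> 0" unfolding B_def using assms by auto
    \<comment> \<open>Writing \<open>y\<close> through the partition of unity turns the weights into
      \<open>x - y\<close>, which removes the one term, \<open>x = y\<close>, that is not
      small.\<close>
    have "y = (\<Sum>x\<in>Y. y * poly (H x) t)"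
      using arg_cong[OF unity, of "\<lambda>p. poly p t"] by (simp add: poly_sum sum_distrib_left[symmetric])
    then have "poly P t - y = (\<Sum>x\<in>Y. x * poly (H x) t) - (\<Sum>x\<in>Y. y * poly (H x) t)"
      by (simp add: P_def poly_sum)
    also have "\<dots> = (\<Sum>x\<in>Y. (x - y) * poly (H x) t)"
      by (simp add: sum_subtractf left_diff_distrib)
    finally have "\<bar>poly P t - y\<bar> \<le> (\<Sum>x\<in>Y. \<bar>(x - y) * poly (H x) t\<bar>)"
      by (simp add: sum_abs)
    also have "\<dots> \<le> of_nat (card Y) * (D * B ^ k)"
    proof (rule sum_bounded_above)
      fix x assume x: "x \<in> Y"
      show "\<bar>(x - y) * poly (H x) t\<bar> \<le> D * B ^ k"
        using D[OF x y] HB[OF x] \<open>B \<ge> 0\<close> assms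
        by (cases "x = y") (auto simp: abs_mult intro!: mult_mono)
    qed
    finally show ?thesis by simp
  qed
  ultimately show ?thesis
    unfolding approximable_within_def B_def by blast
qed

section \<open>Exponent zero and the final constant\<close>

text \<open>The midpoint of the range of \<open>Y\<close> is the witness. This settles
  \<open>n + 1 < s\<close>, where the exponent is 0 and the claimed bound is half the
  diameter.\<close>

lemma approximable_within_constant:
  assumes "finite Y" "Y \<noteq> {}"
  shows "approximable_within n Y \<delta> (diameter Y / 2)"
proof -
  have "\<bar>poly [:(Max Y + Min Y) / 2:] t - y\<bar> \<le> diameter Y / 2" if "y \<in> Y" for y t
    using Max_ge[OF assms(1) that] Min_le[OF assms(1) that]
    unfolding diameter_eq_Max_minus_Min[OF assms] by (simp add: abs_le_iff field_simps)
  then show ?thesis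
    unfolding approximable_within_def by (intro exI[of _ "[:(Max Y + Min Y) / 2:]"]) simp
qed

lemma min_sep_le:
  assumes "finite Y" "y \<in> Y" "z \<in> Y" "y \<noteq> z"
  shows "min_sep Y \<le> \<bar>y - z\<bar>"
proof -
  have "{\<bar>a - b\<bar> | a b. a \<in> Y \<and> b \<in> Y \<and> a \<noteq> b} \<subseteq> (\<lambda>(a, b). \<bar>a - b\<bar>) ` (Y \<times> Y)" by auto
  then have "finite {\<bar>a - b\<bar> | a b. a \<in> Y \<and> b \<in> Y \<and> a \<noteq> b}"
    using assms(1) by (meson finite_SigmaI finite_imageI finite_subset)
  then show ?thesis
    unfolding min_sep_def using assms by (intro Min_le) auto
qed

theorem mainTheorem4:
  fixes s :: nat and u :: real
  assumes "s \<ge> 2" and "u > 0"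
  shows "\<exists>C::real. C > 0 \<and>
    (\<forall>(Y::real set) (\<delta>::real).
       finite Y \<and> card Y = s \<and> min_sep Y / diameter Y \<ge> u \<and>
       0 < \<delta> \<and> \<delta> < min_sep Y / 2 \<longrightarrow>
       (\<forall>n::nat. best_eps n Y \<delta> \<le>
          diameter Y / 2 * (C * (\<delta> / diameter Y)) ^ ((n + 1) div s)))"
proof -
  \<comment> \<open>This is the base of the Hermite bound for \<open>\<sigma> = u * D\<close> with
    \<open>\<delta> / D\<close> taken out. The factor \<open>2 * real s\<close> in \<open>C\<close>
    pays for the prefactor \<open>card Y * D\<close> relative to \<open>D / 2\<close>.\<close>
  define c where "c = 1 / u * (2 / u) ^ (s - 2) * (2 ^ s * (4 / u))"
  define C where "C = 2 * real s * c"
  have "c > 0" using assms by (simp add: c_def)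
  have "best_eps n Y \<delta> \<le> diameter Y / 2 * (C * (\<delta> / diameter Y)) ^ ((n + 1) div s)"
    if Y: "finite Y" "card Y = s" "min_sep Y / diameter Y \<ge> u" "0 < \<delta>" "\<delta> < min_sep Y / 2"
    for Y \<delta> n
  proof -
    define D where "D = diameter Y"
    define k where "k = (n + 1) div s"
    \<comment> \<open>Using \<open>u * D\<close> in place of the true separation makes all ratios
      depend on \<open>u\<close> alone.\<close>
    define \<sigma> where "\<sigma> = u * D"
    have ne: "Y \<noteq> {}" using Y assms by auto
    have dist: "\<bar>y - z\<bar> \<le> D" if "y \<in> Y" "z \<in> Y" for y z
      using diameter_bounded_bound[OF finite_imp_bounded[OF Y(1)] that]
      by (simp add: D_def dist_real_def)
    obtain y z where yz: "y \<in> Y" "z \<in> Y" "y \<noteq> z"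
      using Y(2) assms(1) by (metis card_le_Suc0_iff_eq Y(1) not_less_eq_eq numeral_2_eq_2)
    then have "D > 0" using dist[of y z] by linarith
    then have sep: "\<sigma> \<le> min_sep Y" using Y(3) by (simp add: \<sigma>_def D_def field_simps)
    have "min_sep Y \<le> D" using min_sep_le[OF Y(1) yz] dist[OF yz(1,2)] by linarith
    then have "\<sigma> \<le> D" "\<delta> \<le> D" using sep Y(4,5) by linarith+
    have "\<sigma> > 0" using \<open>D > 0\<close> assms(2) by (simp add: \<sigma>_def)
    show ?thesis
    proof (cases "k = 0")
      case True
      then show ?thesis
        using best_eps_le[OF Y(1) ne Y(4) approximable_within_constant[OF Y(1) ne]]
        by (simp add: k_def)
    next
      case False
      have "approximable_within n Y \<delta>
        (real (card Y) * D * (\<delta> / \<sigma> * (2 * D / \<sigma>) ^ (card Y - 2) * (2 ^ card Y * (4 * D / \<sigma>))) ^ k)"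
      proof (rule approximable_within_hermite)
        show "card Y * k \<le> n + 1" using Y(2) by (simp add: k_def)
        show "\<sigma> \<le> \<bar>y - z\<bar>" if "y \<in> Y" "z \<in> Y" "y \<noteq> z" for y z
          using min_sep_le[OF Y(1) that] sep by linarith
      qed (use Y assms False dist \<open>\<sigma> > 0\<close> \<open>\<sigma> \<le> D\<close> \<open>\<delta> \<le> D\<close> in auto)
      then have "best_eps n Y \<delta> \<le>
        card Y * D * (\<delta> / \<sigma> * (2 * D / \<sigma>) ^ (card Y - 2) * (2 ^ card Y * (4 * D / \<sigma>))) ^ k"
        by (rule best_eps_le[OF Y(1) ne Y(4)])
      also have "\<delta> / \<sigma> * (2 * D / \<sigma>) ^ (card Y - 2) * (2 ^ card Y * (4 * D / \<sigma>)) = c * (\<delta> / D)"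
        using \<open>D > 0\<close> assms(2) by (simp add: c_def \<sigma>_def Y(2) mult_ac)
      also have "card Y * D * (c * (\<delta> / D)) ^ k = D / 2 * ((2 * real s) * (c * (\<delta> / D)) ^ k)"
        by (simp add: Y(2))
      \<comment> \<open>As \<open>k\<close> is positive and \<open>2 * real s\<close> is at least 1,
        the prefactor can be moved under the power.\<close>
      also have "\<dots> \<le> D / 2 * ((2 * real s) ^ k * (c * (\<delta> / D)) ^ k)"
        using False assms(1) \<open>D > 0\<close> \<open>c > 0\<close> Y(4)
        by (intro mult_left_mono mult_right_mono self_le_power) auto
      also have "\<dots> = D / 2 * (C * (\<delta> / D)) ^ k"
        by (simp only: C_def power_mult_distrib mult_ac)
      finally show ?thesis by (simp add: D_def k_def)
    qed
  qed
  moreover have "C > 0" using \<open>c > 0\<close> assms(1) by (simp add: C_def)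
  ultimately show ?thesis by blast
qed

end
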